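(* Let $n$ and $q$ be positive integers with $2n < q$ such that $q^2 - nq + 1$ is prime. If $\mathcal{Q}$ is a finite generalized quadrangle of order $(q^2 - nq, q)$, then $\mathcal{Q}$ does not have an automorphism of order $q^2 - nq + 1$, and, moreover, $\mathcal{Q}$ does not have a group of automorphisms that is transitive on its points.
   Context: A finite generalized quadrangle of order $(s,t)$, with $s,t$ positive integers, is an incidence structure consisting of a finite set $\mathcal{P}$ of points, a finite set $\mathcal{L}$ of lines disjoint from $\mathcal{P}$, and a symmetric point-line incidence relation such that: each point is incident with exactly $t+1$ lines and each line is incident with exactly $s+1$ points; two distinct points are mutually incident with at most one line, and two distinct lines are mutually incident with at most one point; and for each point $P$ and each line $\ell$ not incident with $P$ there is a unique pair $(P',\ell') \in \mathcal{P}\times\mathcal{L}$ such that $P$ is incident with $\ell'$, $\ell'$ is incident with $P'$, and $P'$ is incident with $\ell$. An automorphism of $\mathcal{Q}$ is a permutation of the point set that preserves collinearity (two points are collinear if some line is incident with both); it induces a permutation of the lines preserving incidence. The order of an automorphism is its order as an element of the automorphism group. *)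

theory Defs
  imports
    "HOL-Algebra.Group_Action"
    "HOL-Algebra.Multiplicative_Group"
    "HOL-Computational_Algebra.Primes"
begin

text \<open>
  Points and lines live in separate types, so the two sets are disjoint and the symmetric
  point-line incidence relation is a single predicate, of which only the values on
  \<open>points \<times> lines\<close> matter. Nonemptiness of the point set is tacit in the usual definition;
  without it the empty structure would satisfy all the other axioms, for every \<open>s\<close> and \<open>t\<close>.
\<close>

locale generalized_quadrangle =
  fixes points :: "'p set"
    and lines :: "'l set"
    and inc :: "'p \<Rightarrow> 'l \<Rightarrow> bool"
    and s t :: nat
  assumes finite_points: "finite points"
    and finite_lines: "finite lines"
    and points_nonempty: "points \<noteq> {}"
    and s_pos: "s > 0"
    and t_pos: "t > 0"
    and lines_on_point: "P \<in> points \<Longrightarrow> card {l \<in> lines. inc P l} = t + 1"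
    and points_on_line: "l \<in> lines \<Longrightarrow> card {P \<in> points. inc P l} = s + 1"
    and line_unique:
      "\<lbrakk>P \<in> points; Q \<in> points; P \<noteq> Q; l \<in> lines; m \<in> lines;
        inc P l; inc Q l; inc P m; inc Q m\<rbrakk> \<Longrightarrow> l = m"
    and point_unique:
      "\<lbrakk>l \<in> lines; m \<in> lines; l \<noteq> m; P \<in> points; Q \<in> points;
        inc P l; inc P m; inc Q l; inc Q m\<rbrakk> \<Longrightarrow> P = Q"
    and unique_projection:
      "\<lbrakk>P \<in> points; l \<in> lines; \<not> inc P l\<rbrakk> \<Longrightarrow>
        \<exists>!(P', l'). P' \<in> points \<and> l' \<in> lines \<and> inc P l' \<and> inc P' l' \<and> inc P' l"

definition collinear :: "'l set \<Rightarrow> ('p \<Rightarrow> 'l \<Rightarrow> bool) \<Rightarrow> 'p \<Rightarrow> 'p \<Rightarrow> bool" where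
  "collinear lines inc P Q \<longleftrightarrow> (\<exists>l\<in>lines. inc P l \<and> inc Q l)"

text \<open>
  Preservation is required in both directions, so that automorphisms form a group for every
  incidence structure; on a finite point set the forward direction already implies the other.
\<close>

definition automorphisms ::
    "'p set \<Rightarrow> 'l set \<Rightarrow> ('p \<Rightarrow> 'l \<Rightarrow> bool) \<Rightarrow> ('p \<Rightarrow> 'p) set" where
  "automorphisms points lines inc =
    {g \<in> Bij points. \<forall>P\<in>points. \<forall>Q\<in>points.
       collinear lines inc (g P) (g Q) \<longleftrightarrow> collinear lines inc P Q}"

definition automorphism_group ::
    "'p set \<Rightarrow> 'l set \<Rightarrow> ('p \<Rightarrow> 'l \<Rightarrow> bool) \<Rightarrow> ('p \<Rightarrow> 'p) monoid" where
  "automorphism_group points lines inc =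
    BijGroup points\<lparr>carrier := automorphisms points lines inc\<rparr>"

lemma subgroup_automorphisms:
  "subgroup (automorphisms points lines inc) (BijGroup points)"
proof -
  interpret B: group "BijGroup points" by (rule group_BijGroup)
  show ?thesis
  proof (rule B.subgroupI)
    show "automorphisms points lines inc \<subseteq> carrier (BijGroup points)"
      by (auto simp: automorphisms_def BijGroup_def)
    have "(\<lambda>x\<in>points. x) \<in> automorphisms points lines inc"
      by (auto simp: automorphisms_def id_Bij)
    then show "automorphisms points lines inc \<noteq> {}" by blast
  next
    fix g assume g: "g \<in> automorphisms points lines inc"
    then have gB: "g \<in> Bij points"
      and pres: "\<And>P Q. \<lbrakk>P \<in> points; Q \<in> points\<rbrakk> \<Longrightarrow>
        collinear lines inc (g P) (g Q) \<longleftrightarrow> collinear lines inc P Q"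
      by (auto simp: automorphisms_def)
    let ?h = "inv_into points g"
    have img: "g ` points = points" using gB by (simp add: Bij_def bij_betw_def)
    have gh: "g (?h P) = P" and hin: "?h P \<in> points" if "P \<in> points" for P
      using that img by (auto intro: f_inv_into_f inv_into_into)
    have "collinear lines inc (?h P) (?h Q) \<longleftrightarrow> collinear lines inc P Q"
      if "P \<in> points" "Q \<in> points" for P Q
      using pres[of "?h P" "?h Q"] gh hin that by simp
    then show "inv\<^bsub>BijGroup points\<^esub> g \<in> automorphisms points lines inc"
      using gB by (auto simp: inv_BijGroup automorphisms_def restrict_inv_into_Bij)
  next
    fix g h
    assume "g \<in> automorphisms points lines inc" "h \<in> automorphisms points lines inc"
    then show "g \<otimes>\<^bsub>BijGroup points\<^esub> h \<in> automorphisms points lines inc"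
      using Bij_imp_funcset[of h points]
      by (auto simp: automorphisms_def BijGroup_def compose_Bij compose_eq Pi_iff)
  qed
qed

lemma group_automorphism_group: "group (automorphism_group points lines inc)"
  unfolding automorphism_group_def
  by (rule group.subgroup_imp_group[OF group_BijGroup subgroup_automorphisms])

end

theory Submission
  imports Defs "HOL-Algebra.Sylow"
begin

text \<open>
  Put \<open>t = q\<close>, \<open>s = q\<^sup>2 - n q\<close>, \<open>u = q - 2 n\<close> and let \<open>p = s + 1\<close>, a prime with \<open>t + 1 < p\<close>.
  By orbit-stabilizer a point-transitive group has order divisible by \<open>p\<close>, because \<open>p\<close> divides the
  number \<open>(s + 1) (s t + 1)\<close> of points; so both claims follow once an automorphism \<open>g \<noteq> 1\<close> with
  \<open>g\<^sup>p = 1\<close> is excluded.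

  Orbits of \<open>g\<close> have size 1 or \<open>p\<close>. A fixed point would force its \<open>t + 1 < p\<close> lines to be fixed,
  then the \<open>s < p\<close> other points of each of them, and in the end every point. Hence there is no
  fixed point and the fixed lines are pairwise disjoint (\<open>no_fixed_point\<close>, \<open>fixed_disj\<close>).
  The number \<open>f\<close> of fixed lines is congruent modulo \<open>p\<close> to the number
  \<open>(t + 1) (s t + 1) = p t (t + 1) - (t\<^sup>2 - 1)\<close> of all lines (\<open>dvd_fixed\<close>). As \<open>t\<^sup>2 - 1 > p\<close>, this gives
  \<open>f \<ge> 2 p - (t\<^sup>2 - 1) = u t + 3\<close>.

  So many disjoint fixed lines cannot coexist. A point of a fixed line is joined to every other fixed
  line through one of only \<open>t\<close> lines, so one of these, \<open>A\<close>, meets \<open>k \<ge> u + 2\<close> fixed lines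
  (\<open>exists_line_meeting_many_fixed\<close>). The \<open>p\<close> images of \<open>A\<close> and these \<open>k\<close> fixed lines form a grid
  (\<open>grid_of_orbit\<close>). The lines skew to the \<open>k\<close> fixed ones, other than the remaining fixed lines, are
  few because \<open>k\<close> and \<open>f\<close> are large (\<open>card_lines_split\<close>). On the other hand the sum and the sum of
  squares, over these lines, of the number of images of \<open>A\<close> met are determined by \<open>k\<close>, and
  nonnegativity of a variance shows that such lines are many (\<open>skew_lower_bound\<close>). The two bounds
  are incompatible (\<open>grid_counts_contradiction\<close>).

  Lines are treated as sets of points throughout, so that an automorphism acts on them by taking
  images.
\<close>

section \<open>Orbits of maps of prime period\<close>

lemma funpow_image: "((`) g ^^ i) A = (g ^^ i) ` A" for g :: "'a \<Rightarrow> 'a"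
  by (induction i) (auto simp: image_comp)

lemma funpow_fixed: "h x = x \<Longrightarrow> (h ^^ i) x = x"
  by (induction i) auto

lemma funpow_mult_fixed: "(h ^^ d) x = x \<Longrightarrow> (h ^^ (d * i)) x = x"
  using funpow_fixed[of "h ^^ d" x i] by (simp add: funpow_mult mult.commute)

lemma funpow_in: "h ` X \<subseteq> X \<Longrightarrow> x \<in> X \<Longrightarrow> (h ^^ i) x \<in> X"
  by (induction i) auto

text \<open>
  If two of the first \<open>p\<close> iterates agree, then \<open>h\<^sup>d\<close> fixes \<open>x\<close> for some \<open>0 < d < p\<close>; as \<open>d\<close> is
  coprime to the period \<open>p\<close>, a Bezout combination shows that \<open>h\<close> itself fixes \<open>x\<close>.
\<close>

lemma orbit_inj_on_prime_period:
  fixes p :: nat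
  assumes p: "prime p" and per: "(h ^^ p) x = x" and nfix: "h x \<noteq> x"
  shows "inj_on (\<lambda>i. (h ^^ i) x) {..<p}"
proof -
  have False if ij: "i < j" "j < p" and eq: "(h ^^ i) x = (h ^^ j) x" for i j
  proof -
    define d where "d = j - i"
    have d: "0 < d" "d < p" using ij by (auto simp: d_def)
    have "(h ^^ (p - i)) ((h ^^ i) x) = x"
      using ij per by (simp flip: funpow_add comp_apply[of "h ^^ (p - i)"])
    moreover have "(h ^^ (p - i)) ((h ^^ j) x) = (h ^^ d) x"
    proof -
      have "p - i + j = d + p" using ij by (simp add: d_def)
      then have "(h ^^ (p - i + j)) x = (h ^^ (d + p)) x" by simp
      then show ?thesis using per by (simp add: funpow_add)
    qed
    ultimately have fd: "(h ^^ d) x = x" using eq by simp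
    have "coprime d p"
      using d p by (metis coprime_commute prime_imp_coprime nat_dvd_not_less)
    then obtain a b where ab: "d * a = p * b + 1"
      using bezout_nat[of d p] d by auto
    have "(h ^^ (p * b + 1)) x = x"
      using funpow_mult_fixed[OF fd, of a] unfolding ab .
    moreover have "(h ^^ (1 + p * b)) x = h x"
      using funpow_mult_fixed[OF per, of b] by (simp add: funpow_add)
    ultimately show False using nfix by (simp add: add.commute)
  qed
  then show ?thesis
    unfolding inj_on_def by (metis lessThan_iff linorder_neqE_nat)
qed

lemma orbit_prime_period_le_card:
  fixes p :: nat
  assumes "prime p" "(h ^^ p) x = x" "h x \<noteq> x" "finite X" "\<And>i. (h ^^ i) x \<in> X"
  shows "p \<le> card X"
  using card_inj_on_le[OF orbit_inj_on_prime_period[OF assms(1-3)], of X] assms(4,5) by auto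

text \<open>The moved elements split into orbits, each of which has exactly \<open>p\<close> elements.\<close>

lemma prime_period_dvd_card_moved:
  fixes p :: nat
  assumes p: "prime p" and fin: "finite X" and into: "h ` X \<subseteq> X"
    and per: "\<And>x. x \<in> X \<Longrightarrow> (h ^^ p) x = x"
  shows "p dvd card {x \<in> X. h x \<noteq> x}"
proof -
  define orb where "orb x = range (\<lambda>i. (h ^^ i) x)" for x
  have p0: "0 < p" using p prime_gt_0_nat by blast
  have mod: "(h ^^ i) x = (h ^^ (i mod p)) x" if "x \<in> X" for i x
  proof -
    have "(h ^^ (i mod p + p * (i div p))) x = (h ^^ (i mod p)) x"
      using funpow_mult_fixed[OF per[OF that], of "i div p"] by (simp only: funpow_add comp_apply)
    then show ?thesis by simp
  qed
  have orb: "orb x = (\<lambda>i. (h ^^ i) x) ` {..<p}" if "x \<in> X" for x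
  proof -
    have "(h ^^ i) x \<in> (\<lambda>i. (h ^^ i) x) ` {..<p}" for i
      using mod[OF that, of i] p0 by auto
    then show ?thesis unfolding orb_def by auto
  qed
  have orb_sub: "orb x \<subseteq> X" if "x \<in> X" for x
    using funpow_in[OF into that] by (auto simp: orb_def)
  have return: "\<exists>j. (h ^^ j) y = x" if x: "x \<in> X" and y: "y \<in> orb x" for x y
  proof -
    obtain i where i: "i < p" "y = (h ^^ i) x" using y orb[OF x] by auto
    have "(h ^^ (p - i + i)) x = x" using i per[OF x] by simp
    then have "(h ^^ (p - i)) y = x" unfolding i(2) funpow_add by simp
    then show ?thesis by blast
  qed
  have trans: "orb y \<subseteq> orb x" if y: "y \<in> orb x" for x y
    using y by (auto simp: orb_def simp flip: funpow_add comp_apply[of "h ^^ _"])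
  have eq: "orb y = orb x" if x: "x \<in> X" and y: "y \<in> orb x" for x y
  proof -
    have "x \<in> orb y" using return[OF x y] by (auto simp: orb_def)
    then show ?thesis using trans y by blast
  qed
  have self: "x \<in> orb x" for x unfolding orb_def by (metis funpow_0 rangeI)
  have hx: "h x \<in> orb x" for x
    unfolding orb_def by (rule range_eqI[of _ _ 1]) simp
  let ?M = "{x \<in> X. h x \<noteq> x}"
  have orbM: "orb x \<subseteq> ?M" if x: "x \<in> ?M" for x
  proof
    fix y assume y: "y \<in> orb x"
    then obtain j where j: "(h ^^ j) y = x" using return x by blast
    have "h y \<noteq> y" using funpow_fixed[of h y j] j x by auto
    then show "y \<in> ?M" using orb_sub x y by auto
  qed
  have U: "?M = \<Union> (orb ` ?M)" using self orbM by blast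
  have "p dvd card (\<Union> (orb ` ?M))"
  proof (rule dvd_partition)
    show "finite (\<Union> (orb ` ?M))" using U fin by simp
    have "card (orb x) = p" if "x \<in> ?M" for x
      using orbit_inj_on_prime_period[OF p per, of x] that orb[of x]
      by (simp add: card_image)
    then show "\<forall>c\<in>orb ` ?M. p dvd card c" by simp
    have "orb x = orb y" if "x \<in> X" "y \<in> X" "z \<in> orb x" "z \<in> orb y" for x y z
      using eq that by metis
    then show "\<forall>c1\<in>orb ` ?M. \<forall>c2\<in>orb ` ?M. c1 \<noteq> c2 \<longrightarrow> c1 \<inter> c2 = {}"
      by (clarsimp simp: disjoint_iff)
  qed
  then show ?thesis using U by simp
qed

section \<open>Counting in a quadrangle\<close>

lemma card_UN_const:
  assumes "finite I" "\<And>i. i \<in> I \<Longrightarrow> finite (A i)" "\<And>i. i \<in> I \<Longrightarrow> card (A i) = c"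
    and "\<And>i j x. i \<in> I \<Longrightarrow> j \<in> I \<Longrightarrow> x \<in> A i \<Longrightarrow> x \<in> A j \<Longrightarrow> i = j"
  shows "card (\<Union>i\<in>I. A i) = card I * c"
proof -
  have "card (\<Union>i\<in>I. A i) = (\<Sum>i\<in>I. card (A i))"
    by (rule card_UN_disjoint) (use assms in blast)+
  then show ?thesis using assms by simp
qed

text \<open>
  A generalized quadrangle with each line replaced by the set of its points. The unique projection
  of a point onto a line is split into its existence, \<open>projection\<close>, and its uniqueness, which says
  that three lines meeting pairwise pass through one point.
\<close>

locale quadrangle =
  fixes P :: "'p set" and L :: "'p set set" and s t :: nat
  assumes finite_P: "finite P"
    and line_sub: "A \<in> L \<Longrightarrow> A \<subseteq> P"
    and s_pos: "s > 0" and t_pos: "t > 0"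
    and P_nonempty: "P \<noteq> {}"
    and card_line: "A \<in> L \<Longrightarrow> card A = s + 1"
    and card_pencil: "x \<in> P \<Longrightarrow> card {A \<in> L. x \<in> A} = t + 1"
    and meet_unique: "\<lbrakk>A \<in> L; B \<in> L; A \<noteq> B; x \<in> A; x \<in> B; y \<in> A; y \<in> B\<rbrakk> \<Longrightarrow> x = y"
    and projection: "\<lbrakk>x \<in> P; A \<in> L; x \<notin> A\<rbrakk> \<Longrightarrow> \<exists>B\<in>L. x \<in> B \<and> B \<inter> A \<noteq> {}"
    and no_triangle: "\<lbrakk>A \<in> L; B \<in> L; C \<in> L; A \<noteq> B; x \<in> A; x \<in> B; A \<inter> C \<noteq> {}; B \<inter> C \<noteq> {}\<rbrakk>
      \<Longrightarrow> x \<in> C"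
begin

lemma finite_line: "A \<in> L \<Longrightarrow> finite A"
  using line_sub finite_P finite_subset by blast

lemma finite_L: "finite L"
  by (rule finite_subset[of _ "Pow P"]) (use line_sub finite_P in auto)

lemma line_nonempty: "A \<in> L \<Longrightarrow> A \<noteq> {}"
  using card_line by force

lemma exists_line: "x \<in> P \<Longrightarrow> \<exists>A\<in>L. x \<in> A"
  using card_pencil[of x] by (metis (no_types, lifting) add_is_0 card.empty empty_Collect_eq one_neq_zero)

lemma card_meeting:
  assumes A: "A \<in> L"
  shows "card {B \<in> L. B \<noteq> A \<and> B \<inter> A \<noteq> {}} = (s + 1) * t"
proof -
  have eq: "{B \<in> L. B \<noteq> A \<and> B \<inter> A \<noteq> {}} = (\<Union>x\<in>A. {B \<in> L. x \<in> B} - {A})" by auto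
  have "card (\<Union>x\<in>A. {B \<in> L. x \<in> B} - {A}) = card A * t"
  proof (rule card_UN_const)
    show "finite A" using A finite_line by blast
    show "finite ({B \<in> L. x \<in> B} - {A})" for x using finite_L by simp
    show "card ({B \<in> L. x \<in> B} - {A}) = t" if "x \<in> A" for x
      using card_pencil[of x] A line_sub[OF A] that by (subst card_Diff_singleton) auto
    show "x = y" if "x \<in> A" "y \<in> A" "B \<in> {B \<in> L. x \<in> B} - {A}" "B \<in> {B \<in> L. y \<in> B} - {A}"
      for x y B using meet_unique[of A B x y] A that by auto
  qed
  then show ?thesis using eq A card_line by simp
qed

text \<open>
  By projection onto an arbitrary line \<open>A\<close>, each point off \<open>A\<close> lies on exactly one of the lines that meet
  \<open>A\<close>.
\<close>

lemma card_points: "card P = (s + 1) * (s * t + 1)"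
proof -
  obtain A where A: "A \<in> L" using exists_line P_nonempty by blast
  let ?M = "{B \<in> L. B \<noteq> A \<and> B \<inter> A \<noteq> {}}"
  have "P - A = (\<Union>B\<in>?M. B - A)"
    using projection[OF _ A] line_sub by fastforce
  also have "card \<dots> = card ?M * s"
  proof (rule card_UN_const)
    show "finite ?M" using finite_L by simp
    show "finite (B - A)" if "B \<in> ?M" for B using that finite_line by auto
    show "card (B - A) = s" if B: "B \<in> ?M" for B
    proof -
      obtain x where "x \<in> B" "x \<in> A" using B by auto
      then have "B - A = B - {x}" using meet_unique[of A B x] A B by blast
      then show ?thesis using B \<open>x \<in> B\<close> card_line[of B] finite_line[of B] by simp
    qed
    show "B = C" if "B \<in> ?M" "C \<in> ?M" "x \<in> B - A" "x \<in> C - A" for B C x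
      using no_triangle[of B C A x] A that by auto
  qed
  finally have "card (P - A) = (s + 1) * t * s" using card_meeting[OF A] by simp
  moreover have "card P = card (P - A) + card A"
    using card_mono[OF finite_P line_sub[OF A]] line_sub[OF A] finite_line[OF A]
    by (simp add: card_Diff_subset)
  ultimately show ?thesis using card_line[OF A] by (simp add: algebra_simps)
qed

text \<open>Flags are counted in two ways.\<close>

lemma card_lines: "card L = (t + 1) * (s * t + 1)"
proof -
  have "(\<Sum>A\<in>L. card {x \<in> P. x \<in> A}) = (t + 1) * card P"
    by (rule sum_multicount) (use finite_L finite_P card_pencil in auto)
  moreover have "{x \<in> P. x \<in> A} = A" if "A \<in> L" for A using line_sub[OF that] by auto
  ultimately have "card L * (s + 1) = (t + 1) * ((s + 1) * (s * t + 1))"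
    using card_line card_points by simp
  then have "(s + 1) * card L = (s + 1) * ((t + 1) * (s * t + 1))"
    by (simp only: ac_simps)
  then show ?thesis by (simp only: mult_cancel1) simp
qed

text \<open>Projecting the points of \<open>A\<close> onto \<open>B\<close> yields one transversal through each of them.\<close>

lemma card_transversals:
  assumes A: "A \<in> L" and B: "B \<in> L" and AB: "A \<inter> B = {}"
  shows "card {C \<in> L. C \<inter> A \<noteq> {} \<and> C \<inter> B \<noteq> {}} = s + 1"
proof -
  have eq: "{C \<in> L. C \<inter> A \<noteq> {} \<and> C \<inter> B \<noteq> {}} = (\<Union>x\<in>A. {C \<in> L. x \<in> C \<and> C \<inter> B \<noteq> {}})"
    by auto
  have "card (\<Union>x\<in>A. {C \<in> L. x \<in> C \<and> C \<inter> B \<noteq> {}}) = card A * 1"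
  proof (rule card_UN_const)
    show "finite A" using A finite_line by blast
    show "finite {C \<in> L. x \<in> C \<and> C \<inter> B \<noteq> {}}" for x using finite_L by simp
    show "card {C \<in> L. x \<in> C \<and> C \<inter> B \<noteq> {}} = 1" if x: "x \<in> A" for x
    proof -
      have "x \<in> P" "x \<notin> B" using x AB line_sub[OF A] by auto
      then obtain C where C: "C \<in> L" "x \<in> C" "C \<inter> B \<noteq> {}" using projection[of x B] B by auto
      have "{C \<in> L. x \<in> C \<and> C \<inter> B \<noteq> {}} = {C}"
        using C no_triangle[OF _ C(1) B _ _ C(2) _ C(3)] \<open>x \<notin> B\<close> by auto
      then show ?thesis by simp
    qed
    show "x = y" if "x \<in> A" "y \<in> A" "C \<in> {C \<in> L. x \<in> C \<and> C \<inter> B \<noteq> {}}"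
        "C \<in> {C \<in> L. y \<in> C \<and> C \<inter> B \<noteq> {}}" for x y C
      using meet_unique[of A C x y] A AB that by auto
  qed
  then show ?thesis using eq A card_line by simp
qed

text \<open>
  Without triangles, a point collinear with two points of a line is on that line. Lines are thereby
  recovered from collinearity alone, and maps preserving collinearity act on them.
\<close>

lemma line_eq_perp:
  assumes A: "A \<in> L" and xy: "x \<in> A" "y \<in> A" "x \<noteq> y"
  shows "A = {z \<in> P. (\<exists>B\<in>L. z \<in> B \<and> x \<in> B) \<and> (\<exists>B\<in>L. z \<in> B \<and> y \<in> B)}"
proof (intro equalityI subsetI)
  fix z assume "z \<in> A"
  then show "z \<in> {z \<in> P. (\<exists>B\<in>L. z \<in> B \<and> x \<in> B) \<and> (\<exists>B\<in>L. z \<in> B \<and> y \<in> B)}"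
    using A xy line_sub by auto
next
  fix z assume "z \<in> {z \<in> P. (\<exists>B\<in>L. z \<in> B \<and> x \<in> B) \<and> (\<exists>B\<in>L. z \<in> B \<and> y \<in> B)}"
  then obtain B C where BC: "B \<in> L" "C \<in> L" "z \<in> B" "x \<in> B" "z \<in> C" "y \<in> C" by auto
  show "z \<in> A"
  proof (cases "B = C")
    case True
    then have "B = A" using meet_unique[of A B x y] A BC xy by auto
    then show ?thesis using BC by simp
  next
    case False
    then show ?thesis using no_triangle[of B C A z] A BC xy by auto
  qed
qed

end

section \<open>Grids\<close>

text \<open>
  The rows \<open>R\<close> and the columns \<open>K\<close> form a grid in which the rows are complete: every point of a
  column is on a row. The set \<open>Z\<close> collects lines known to miss the grid altogether; taking them out
  of the count of lines skew to the columns makes the final estimate sharp enough.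
\<close>

locale quadrangle_grid = quadrangle +
  fixes R K Z :: "'a set set"
  assumes R_sub: "R \<subseteq> L" and K_sub: "K \<subseteq> L" and Z_sub: "Z \<subseteq> L"
    and card_R: "card R = s + 1" and card_K: "2 \<le> card K"
    and R_disj: "\<lbrakk>A \<in> R; A' \<in> R; A \<noteq> A'\<rbrakk> \<Longrightarrow> A \<inter> A' = {}"
    and K_disj: "\<lbrakk>B \<in> K; B' \<in> K; B \<noteq> B'\<rbrakk> \<Longrightarrow> B \<inter> B' = {}"
    and RK_meet: "\<lbrakk>A \<in> R; B \<in> K\<rbrakk> \<Longrightarrow> A \<inter> B \<noteq> {}"
    and RK_distinct: "R \<inter> K = {}"
    and Z_skew: "\<lbrakk>C \<in> Z; A \<in> R \<union> K\<rbrakk> \<Longrightarrow> C \<inter> A = {}"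
begin

definition skew :: "'a set set" where
  "skew = {C \<in> L. C \<notin> Z \<and> (\<forall>B\<in>K. C \<inter> B = {})}"

lemma fin: "finite R" "finite K" "finite Z" "finite skew"
  using finite_L R_sub K_sub Z_sub finite_subset by (auto simp: skew_def)

text \<open>Two columns have only \<open>s + 1\<close> transversals, and the rows already are that many.\<close>

lemma transversals_eq:
  assumes "B \<in> K" "B' \<in> K" "B \<noteq> B'"
  shows "{C \<in> L. C \<inter> B \<noteq> {} \<and> C \<inter> B' \<noteq> {}} = R"
proof (rule sym, rule card_subset_eq)
  show "finite {C \<in> L. C \<inter> B \<noteq> {} \<and> C \<inter> B' \<noteq> {}}" using finite_L by simp
  show "R \<subseteq> {C \<in> L. C \<inter> B \<noteq> {} \<and> C \<inter> B' \<noteq> {}}" 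
    using RK_meet[OF _ assms(1)] RK_meet[OF _ assms(2)] R_sub by blast
  show "card R = card {C \<in> L. C \<inter> B \<noteq> {} \<and> C \<inter> B' \<noteq> {}}"
    using card_transversals[OF subsetD[OF K_sub assms(1)] subsetD[OF K_sub assms(2)]
      K_disj[OF assms]] card_R by (rule trans[OF _ sym, rotated])
qed

text \<open>
  A line outside \<open>Z\<close> is a column, a row, a line that meets exactly one column without being a row,
  or is skew to all columns. Each column meets \<open>(s + 1) t\<close> other lines, of which \<open>s + 1\<close> are rows.
\<close>

lemma card_lines_split:
  "card L = card Z + card K + (s + 1) + card K * ((s + 1) * (t - 1)) + card skew"
proof -
  define M where "M B = {C \<in> L. C \<noteq> B \<and> C \<inter> B \<noteq> {}} - R" for B
  have cM: "card (\<Union>B\<in>K. M B) = card K * ((s + 1) * (t - 1))"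
  proof (rule card_UN_const)
    show "finite K" by (rule fin)
    show "finite (M B)" for B using finite_L by (simp add: M_def)
    show "card (M B) = (s + 1) * (t - 1)" if B: "B \<in> K" for B
    proof -
      have "R \<subseteq> {C \<in> L. C \<noteq> B \<and> C \<inter> B \<noteq> {}}"
        using RK_meet[OF _ B] RK_distinct R_sub B by blast
      then have "card (M B) = (s + 1) * t - (s + 1)"
        unfolding M_def using card_meeting[of B] B K_sub fin card_R by (subst card_Diff_subset) auto
      then show ?thesis by (simp add: diff_mult_distrib2)
    qed
    show "B = B'" if "B \<in> K" "B' \<in> K" "C \<in> M B" "C \<in> M B'" for B B' C
      using transversals_eq[of B B'] that by (auto simp: M_def)
  qed
  have K0: "K \<noteq> {}" using card_K by auto
  have ne: "C \<inter> C \<noteq> {}" if "C \<in> L" for C using line_nonempty that by simp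
  have U: "L = Z \<union> (K \<union> (R \<union> ((\<Union>B\<in>K. M B) \<union> skew)))"
    using K_sub R_sub Z_sub by (auto simp: M_def skew_def)
  have d1: "((\<Union>B\<in>K. M B) \<inter> skew) = {}" by (auto simp: M_def skew_def)
  have d2: "R \<inter> ((\<Union>B\<in>K. M B) \<union> skew) = {}"
    using RK_meet K0 by (fastforce simp: M_def skew_def)
  have d3: "K \<inter> (R \<union> ((\<Union>B\<in>K. M B) \<union> skew)) = {}"
  proof -
    have "C \<notin> M B" if "C \<in> K" "B \<in> K" for B C using K_disj[of C B] that by (auto simp: M_def)
    moreover have "C \<notin> skew" if "C \<in> K" for C using ne[of C] K_sub that by (auto simp: skew_def)
    ultimately show ?thesis using RK_distinct by blast
  qed
  have d4: "Z \<inter> (K \<union> (R \<union> ((\<Union>B\<in>K. M B) \<union> skew))) = {}"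
  proof -
    have "C \<notin> K \<union> R" if "C \<in> Z" for C using Z_skew[OF that, of C] ne[of C] Z_sub that by auto
    moreover have "C \<notin> M B" if "C \<in> Z" "B \<in> K" for B C
      using Z_skew[of C B] that by (auto simp: M_def)
    ultimately show ?thesis by (auto simp: skew_def)
  qed
  have fM: "finite (\<Union>B\<in>K. M B)" using finite_L fin by (simp add: M_def)
  have f1: "finite ((\<Union>B\<in>K. M B) \<union> skew)" using fM fin(4) by (rule finite_UnI)
  have f2: "finite (R \<union> ((\<Union>B\<in>K. M B) \<union> skew))" using fin(1) f1 by (rule finite_UnI)
  have f3: "finite (K \<union> (R \<union> ((\<Union>B\<in>K. M B) \<union> skew)))" using fin(2) f2 by (rule finite_UnI)
  have "card L = card Z + (card K + (card R + (card (\<Union>B\<in>K. M B) + card skew)))"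
    using arg_cong[OF U, of card] unfolding card_Un_disjoint[OF fin(3) f3 d4]
      card_Un_disjoint[OF fin(2) f2 d3] card_Un_disjoint[OF fin(1) f1 d2]
      card_Un_disjoint[OF fM fin(4) d1] .
  then show ?thesis unfolding cM card_R by (simp only: ac_simps)
qed

text \<open>
  The disjoint columns meet a row in distinct points, one each. Integers avoid the truncated
  subtraction of natural numbers in the products formed below.
\<close>

lemma card_off_grid:
  assumes A: "A \<in> R"
  shows "int (card (A - \<Union>K)) = int (s + 1) - int (card K)"
proof -
  have AL: "A \<in> L" using A R_sub by auto
  have "card (\<Union>B\<in>K. A \<inter> B) = card K * 1"
  proof (rule card_UN_const)
    show "finite K" by (rule fin)
    show "finite (A \<inter> B)" for B using finite_line[OF AL] by simp
    show "card (A \<inter> B) = 1" if B: "B \<in> K" for B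
    proof -
      obtain x where x: "x \<in> A \<inter> B" using RK_meet[OF A B] by auto
      have "A \<noteq> B" using A B RK_distinct by auto
      then have "A \<inter> B = {x}" using x meet_unique[of A B _ x] AL B K_sub by auto
      then show ?thesis by simp
    qed
    show "B = B'" if "B \<in> K" "B' \<in> K" "x \<in> A \<inter> B" "x \<in> A \<inter> B'" for B B' x
      using K_disj[of B B'] that by auto
  qed
  moreover have "A \<inter> \<Union>K = (\<Union>B\<in>K. A \<inter> B)" by blast
  ultimately have "card (A \<inter> \<Union>K) = card K" by (simp only: mult_1_right)
  moreover have "card A = card (A - \<Union>K) + card (A \<inter> \<Union>K)"
    using card_Int_Diff[OF finite_line[OF AL], of "\<Union>K"] by (simp only: add.commute)
  ultimately show ?thesis using card_line[OF AL] by simp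
qed

text \<open>
  A line other than the row \<open>A\<close> that meets \<open>A\<close> off the columns cannot meet a column, since it would
  form a triangle with that column and \<open>A\<close>.
\<close>

lemma card_skew_meeting:
  assumes A: "A \<in> R"
  shows "int (card {C \<in> skew. C \<inter> A \<noteq> {}}) = (int (s + 1) - int (card K)) * int t"
proof -
  have AL: "A \<in> L" using A R_sub by auto
  have "{C \<in> skew. C \<inter> A \<noteq> {}} = (\<Union>x\<in>A - \<Union>K. {C \<in> L. x \<in> C} - {A})"
  proof (intro equalityI subsetI)
    fix C assume C: "C \<in> {C \<in> skew. C \<inter> A \<noteq> {}}"
    then obtain x where x: "x \<in> C" "x \<in> A" by auto
    have "x \<notin> \<Union>K" using C x by (auto simp: skew_def)
    moreover have "C \<noteq> A"
    proof
      assume "C = A"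
      moreover obtain B where "B \<in> K" using card_K by fastforce
      ultimately show False using C RK_meet[OF A, of B] by (auto simp: skew_def)
    qed
    ultimately show "C \<in> (\<Union>x\<in>A - \<Union>K. {C \<in> L. x \<in> C} - {A})"
      using C x by (auto simp: skew_def)
  next
    fix C assume "C \<in> (\<Union>x\<in>A - \<Union>K. {C \<in> L. x \<in> C} - {A})"
    then obtain x where x: "x \<in> A" "x \<notin> \<Union>K" "C \<in> L" "x \<in> C" "C \<noteq> A" by auto
    have "C \<inter> B = {}" if B: "B \<in> K" for B
      using no_triangle[of A C B x] RK_meet[OF A B] B K_sub AL x by auto
    moreover have "C \<notin> Z" using Z_skew[of C A] A x by auto
    ultimately show "C \<in> {C \<in> skew. C \<inter> A \<noteq> {}}" using x by (auto simp: skew_def)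
  qed
  also have "card \<dots> = card (A - \<Union>K) * t"
  proof (rule card_UN_const)
    show "finite (A - \<Union>K)" using finite_line[OF AL] by simp
    show "finite ({C \<in> L. x \<in> C} - {A})" for x using finite_L by simp
    show "card ({C \<in> L. x \<in> C} - {A}) = t" if "x \<in> A - \<Union>K" for x
      using card_pencil[of x] AL line_sub[OF AL] that by (subst card_Diff_singleton) auto
    show "x = y" if "x \<in> A - \<Union>K" "y \<in> A - \<Union>K" "C \<in> {C \<in> L. x \<in> C} - {A}"
        "C \<in> {C \<in> L. y \<in> C} - {A}" for x y C
      using meet_unique[of A C x y] AL that by auto
  qed
  finally show ?thesis using card_off_grid[OF A] by simp
qed

text \<open>
  Among the \<open>s + 1\<close> transversals of two rows are all columns. Any other transversal is skew to every
  column: otherwise, by the absence of triangles, it would meet the column in a point on both rows,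
  which are disjoint.
\<close>

lemma card_skew_meeting2:
  assumes A: "A \<in> R" and A': "A' \<in> R" and ne: "A \<noteq> A'"
  shows "int (card {C \<in> skew. C \<inter> A \<noteq> {} \<and> C \<inter> A' \<noteq> {}}) = int (s + 1) - int (card K)"
proof -
  have AL: "A \<in> L" "A' \<in> L" using A A' R_sub by auto
  note disj = R_disj[OF A A' ne]
  let ?T = "{C \<in> L. C \<inter> A \<noteq> {} \<and> C \<inter> A' \<noteq> {}}"
  have KT: "K \<subseteq> ?T" using RK_meet[OF A] RK_meet[OF A'] K_sub by blast
  have "{C \<in> skew. C \<inter> A \<noteq> {} \<and> C \<inter> A' \<noteq> {}} = ?T - K"
  proof (intro equalityI subsetI)
    fix C assume C: "C \<in> {C \<in> skew. C \<inter> A \<noteq> {} \<and> C \<inter> A' \<noteq> {}}"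
    then show "C \<in> ?T - K" using line_nonempty[of C] by (auto simp: skew_def)
  next
    fix C assume C: "C \<in> ?T - K"
    have "C \<inter> B = {}" if B: "B \<in> K" for B
    proof (rule ccontr)
      assume "C \<inter> B \<noteq> {}"
      then obtain x where x: "x \<in> C" "x \<in> B" by auto
      have BC: "C \<in> L" "B \<in> L" "C \<noteq> B" using C B K_sub by auto
      have "B \<inter> A \<noteq> {}" "B \<inter> A' \<noteq> {}" using RK_meet A A' B by blast+
      then have "x \<in> A" "x \<in> A'"
        using no_triangle[OF BC(1,2) _ BC(3) x] AL C by auto
      then show False using disj by auto
    qed
    moreover have "C \<notin> Z" using Z_skew[of C A] A C by auto
    ultimately show "C \<in> {C \<in> skew. C \<inter> A \<noteq> {} \<and> C \<inter> A' \<noteq> {}}"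
      using C by (auto simp: skew_def)
  qed
  moreover have "card (?T - K) = card ?T - card K" using KT fin by (simp add: card_Diff_subset)
  moreover have "card K \<le> card ?T" using KT finite_L by (simp add: card_mono)
  ultimately show ?thesis using card_transversals[OF AL disj] by simp
qed

text \<open>
  Let \<open>m C\<close> be the number of rows met by a skew line \<open>C\<close>. The two preceding lemmas give the sums of
  \<open>m\<close> and of \<open>m\<^sup>2\<close> over the skew lines; the second is \<open>(s + t) / t\<close> times the first. The estimate is
  the nonnegativity of the sum of the squares of \<open>t m - (s + t)\<close>, which is the Cauchy-Schwarz
  inequality with the optimal multiplier inserted; used directly, Cauchy-Schwarz would require a
  division by \<open>s + 1 - card K\<close>, which might be zero.
\<close>

lemma skew_lower_bound:
  "(int (s + 1) * (int (s + 1) - int (card K))) * (int t)\<^sup>2 \<le> int (card skew) * int (s + t)"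
proof -
  define p k where "p = int (s + 1)" and "k = int (card K)"
  define b where "b C A = (of_bool (C \<inter> A \<noteq> {}) :: int)" for C A :: "'a set"
  define m where "m C = (\<Sum>A\<in>R. b C A)" for C
  have count: "(\<Sum>C\<in>skew. of_bool (Q C)) = int (card {C \<in> skew. Q C})" for Q
    using fin(4) by (simp add: of_bool_def sum.If_cases Int_def)
  have s1: "(\<Sum>C\<in>skew. m C) = p * ((p - k) * int t)"
  proof -
    have "(\<Sum>C\<in>skew. m C) = (\<Sum>A\<in>R. \<Sum>C\<in>skew. b C A)" unfolding m_def by (rule sum.swap)
    also have "\<dots> = (\<Sum>A\<in>R. (p - k) * int t)"
      using card_skew_meeting by (intro sum.cong) (simp_all add: b_def count p_def k_def)
    finally show ?thesis by (simp add: card_R p_def)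
  qed
  have s2: "(\<Sum>C\<in>skew. (m C)\<^sup>2) = p * ((p - k) * int t + (p - 1) * (p - k))"
  proof -
    have "(\<Sum>C\<in>skew. (m C)\<^sup>2) = (\<Sum>C\<in>skew. \<Sum>A\<in>R. \<Sum>A'\<in>R. b C A * b C A')"
      by (simp add: m_def power2_eq_square sum_product)
    also have "\<dots> = (\<Sum>A\<in>R. \<Sum>C\<in>skew. \<Sum>A'\<in>R. b C A * b C A')" by (rule sum.swap)
    also have "\<dots> = (\<Sum>A\<in>R. \<Sum>A'\<in>R. \<Sum>C\<in>skew. b C A * b C A')"
      by (intro sum.cong refl sum.swap)
    also have "\<dots> = (\<Sum>A\<in>R. (p - k) * int t + (p - 1) * (p - k))"
    proof (intro sum.cong refl)
      fix A assume A: "A \<in> R"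
      have "(\<Sum>A'\<in>R. \<Sum>C\<in>skew. b C A * b C A')
          = (\<Sum>C\<in>skew. b C A * b C A) + (\<Sum>A'\<in>R - {A}. \<Sum>C\<in>skew. b C A * b C A')"
        using A fin by (simp add: sum.remove)
      also have "(\<Sum>C\<in>skew. b C A * b C A) = (p - k) * int t"
        using card_skew_meeting[OF A] count[of "\<lambda>C. C \<inter> A \<noteq> {}"]
        by (simp add: b_def p_def k_def flip: of_bool_conj)
      also have "(\<Sum>A'\<in>R - {A}. \<Sum>C\<in>skew. b C A * b C A') = (\<Sum>A'\<in>R - {A}. p - k)"
      proof (intro sum.cong refl)
        fix A' assume "A' \<in> R - {A}"
        then show "(\<Sum>C\<in>skew. b C A * b C A') = p - k"
          using card_skew_meeting2[OF A, of A'] count[of "\<lambda>C. C \<inter> A \<noteq> {} \<and> C \<inter> A' \<noteq> {}"]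
          by (auto simp: b_def p_def k_def simp flip: of_bool_conj)
      qed
      also have "\<dots> = (p - 1) * (p - k)" using A fin card_R by (simp add: p_def)
      finally show "(\<Sum>A'\<in>R. \<Sum>C\<in>skew. b C A * b C A')
        = (p - k) * int t + (p - 1) * (p - k)" .
    qed
    finally show ?thesis by (simp add: card_R p_def)
  qed
  let ?v = "int (s + t)"
  have "0 \<le> (\<Sum>C\<in>skew. (int t * m C - ?v)\<^sup>2)" by (rule sum_nonneg) simp
  also have "\<dots> = (\<Sum>C\<in>skew. (int t)\<^sup>2 * (m C)\<^sup>2 - 2 * int t * ?v * m C + ?v\<^sup>2)"
    by (intro sum.cong refl) (simp add: power2_eq_square algebra_simps)
  also have "\<dots> = (int t)\<^sup>2 * (\<Sum>C\<in>skew. (m C)\<^sup>2) - 2 * int t * ?v * (\<Sum>C\<in>skew. m C)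
      + int (card skew) * ?v\<^sup>2"
    by (simp add: sum.distrib sum_subtractf sum_distrib_left)
  also have "\<dots> = ?v * (int (card skew) * ?v - (p * (p - k)) * (int t)\<^sup>2)"
    unfolding s1 s2 by (simp add: p_def power2_eq_square algebra_simps)
  finally have "0 \<le> int (card skew) * ?v - (p * (p - k)) * (int t)\<^sup>2"
    using s_pos by (simp add: zero_le_mult_iff)
  then show ?thesis by (simp add: p_def k_def)
qed

end

section \<open>Automorphisms of period \<open>s + 1\<close>\<close>

text \<open>The condition \<open>t < s\<close> makes the prime \<open>s + 1\<close> exceed the number \<open>t + 1\<close> of lines on a point.\<close>

locale quadrangle_aut = quadrangle +
  fixes g :: "'a \<Rightarrow> 'a"
  assumes bij: "bij_betw g P P"
    and line_image: "A \<in> L \<Longrightarrow> g ` A \<in> L"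
    and period: "x \<in> P \<Longrightarrow> (g ^^ (s + 1)) x = x"
    and nontrivial: "\<exists>x\<in>P. g x \<noteq> x"
    and prime: "prime (s + 1)" and t_less_s: "t < s"
begin

lemma funpow_line: "A \<in> L \<Longrightarrow> (g ^^ i) ` A \<in> L"
  using funpow_in[of "(`) g" L A i] line_image by (auto simp: funpow_image)

lemma funpow_inj: "inj_on (g ^^ i) P"
  using bij_betw_funpow[OF bij, of i] by (rule bij_betw_imp_inj_on)

lemma line_period:
  assumes A: "A \<in> L"
  shows "((`) g ^^ (s + 1)) A = A"
proof -
  have "(g ^^ (s + 1)) ` A = (\<lambda>x. x) ` A"
    using period line_sub[OF A] by (intro image_cong) auto
  then show ?thesis by (simp only: funpow_image image_ident)
qed

text \<open>
  Fixedness spreads along lines: the \<open>t + 1\<close> lines on a fixed point and the \<open>s\<close> further points of such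
  a line are too few to contain an orbit of length \<open>s + 1\<close>. Since any two points are joined by a
  path of at most two lines, a single fixed point would make \<open>g\<close> the identity.
\<close>

lemma no_fixed_point:
  assumes x: "x \<in> P"
  shows "g x \<noteq> x"
proof
  have spread: "g y = y" if fx: "g x = x" and A: "A \<in> L" and xA: "x \<in> A" and yA: "y \<in> A" for x y A
  proof (rule ccontr)
    assume y: "g y \<noteq> y"
    have gA: "g ` A = A"
    proof (rule ccontr)
      assume n: "g ` A \<noteq> A"
      have "x \<in> (g ^^ i) ` A" for i using funpow_fixed[of g x i] fx xA by force
      then have "s + 1 \<le> card {B \<in> L. x \<in> B}"
        using finite_L funpow_line[OF A]
        by (intro orbit_prime_period_le_card[OF prime line_period[OF A] n]) (auto simp: funpow_image)
      moreover have "card {B \<in> L. x \<in> B} = t + 1"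
        using card_pencil line_sub[OF A] xA by auto
      ultimately show False using t_less_s by simp
    qed
    have yP: "y \<in> P" using line_sub[OF A] yA by auto
    have "(g ^^ i) y \<in> A - {x}" for i
    proof -
      have "(g ^^ i) y \<in> A" using funpow_in[of g A y i] gA yA by simp
      moreover have "(g ^^ i) y \<noteq> x"
        using inj_onD[OF funpow_inj[of i], of y x] funpow_fixed[of g x i] fx y yP line_sub[OF A] xA
        by auto
      ultimately show ?thesis by simp
    qed
    then have "s + 1 \<le> card (A - {x})"
      using orbit_prime_period_le_card[OF prime period[OF yP] y] finite_line[OF A] by blast
    then show False using card_line[OF A] xA finite_line[OF A] by simp
  qed
  assume fx: "g x = x"
  obtain A where A: "A \<in> L" "x \<in> A" using exists_line x by blast
  have "g z = z" if z: "z \<in> P" for z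
  proof (cases "z \<in> A")
    case True
    then show ?thesis using spread[OF fx A] by blast
  next
    case False
    then obtain B y where B: "B \<in> L" "z \<in> B" "y \<in> B" "y \<in> A"
      using projection[OF z A(1)] by blast
    show ?thesis using spread[OF spread[OF fx A B(4)] B(1) B(3) B(2)] .
  qed
  then show False using nontrivial by blast
qed

definition fixed :: "'a set set" where
  "fixed = {A \<in> L. g ` A = A}"

lemma fixed_sub: "fixed \<subseteq> L" by (auto simp: fixed_def)

lemma finite_fixed: "finite fixed" using fixed_sub finite_L finite_subset by blast

text \<open>The common point of two fixed lines would be a fixed point.\<close>

lemma fixed_disj: "A \<in> fixed \<Longrightarrow> B \<in> fixed \<Longrightarrow> A \<noteq> B \<Longrightarrow> A \<inter> B = {}"
proof (rule ccontr)
  assume h: "A \<in> fixed" "B \<in> fixed" "A \<noteq> B" "A \<inter> B \<noteq> {}"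
  then obtain x where x: "x \<in> A" "x \<in> B" by auto
  then have "g x \<in> A" "g x \<in> B" using h by (auto simp: fixed_def)
  then have "g x = x" using meet_unique[of A B "g x" x] h x by (simp add: fixed_def)
  then show False using no_fixed_point[of x] x h line_sub[of A] by (auto simp: fixed_def)
qed

lemma fixed_funpow: "A \<in> fixed \<Longrightarrow> (g ^^ i) ` A = A"
  using funpow_fixed[of "(`) g" A i] by (simp add: fixed_def funpow_image)

text \<open>
  The moved lines come in orbits of length \<open>s + 1\<close>, and the number of all lines is congruent to
  \<open>1 - t\<^sup>2\<close> modulo \<open>s + 1\<close>.
\<close>

lemma dvd_fixed: "int (s + 1) dvd int (card fixed) + (int t)\<^sup>2 - 1"
proof -
  have "s + 1 dvd card {A \<in> L. g ` A \<noteq> A}"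
    using line_image by (intro prime_period_dvd_card_moved[OF prime finite_L] line_period) auto
  then obtain c where c: "card {A \<in> L. g ` A \<noteq> A} = (s + 1) * c" by (elim dvdE)
  have "L = fixed \<union> {A \<in> L. g ` A \<noteq> A}" by (auto simp: fixed_def)
  then have "card L = card fixed + (s + 1) * c"
    using card_Un_disjoint[of fixed "{A \<in> L. g ` A \<noteq> A}"] finite_fixed finite_L c
    by (auto simp: fixed_def)
  then have "(t + 1) * (s * t + 1) = card fixed + (s + 1) * c" using card_lines by simp
  then have "int ((t + 1) * (s * t + 1)) = int (card fixed + (s + 1) * c)" by (rule arg_cong)
  then have "int (card fixed) + (int t)\<^sup>2 - 1 = int (s + 1) * (int t * (int t + 1) - int c)"
    by (simp add: power2_eq_square algebra_simps)
  then show ?thesis by (rule dvdI)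
qed

text \<open>
  Each image of \<open>A\<close> meets the same fixed lines as \<open>A\<close>. Two images cannot meet each other: with a
  fixed line \<open>m\<close> that meets \<open>A\<close> they would form a triangle, unless they share their point on \<open>m\<close>;
  but these points form an orbit of length \<open>s + 1\<close>, so that they are distinct.
\<close>

lemma grid_of_orbit:
  assumes A: "A \<in> L" "A \<notin> fixed" and K: "2 \<le> card {B \<in> fixed. B \<inter> A \<noteq> {}}"
  shows "quadrangle_grid P L s t ((\<lambda>i. (g ^^ i) ` A) ` {..<s + 1})
    {B \<in> fixed. B \<inter> A \<noteq> {}} {B \<in> fixed. B \<inter> A = {}}"
    (is "quadrangle_grid P L s t ?R ?K ?Z")
proof -
  obtain m y where my: "m \<in> fixed" "y \<in> m" "y \<in> A"
  proof -
    have "?K \<noteq> {}" using K by (intro notI) simp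
    then show ?thesis using that by blast
  qed
  have mL: "m \<in> L" using my fixed_sub by blast
  have yP: "y \<in> P" using my line_sub[OF A(1)] by blast
  have not_fixed: "(g ^^ i) ` A \<noteq> B" if B: "B \<in> fixed" for i B
  proof
    assume "(g ^^ i) ` A = B"
    then have "(g ^^ i) ` A = (g ^^ i) ` B" using fixed_funpow[OF B] by simp
    moreover have "B \<subseteq> P" using B fixed_sub line_sub by blast
    ultimately have "A = B" using inj_on_image_eq_iff[OF funpow_inj line_sub[OF A(1)]] by metis
    then show False using A B by simp
  qed
  have meet_back: "B \<inter> A \<noteq> {}" if B: "B \<in> fixed" and ne: "B \<inter> (g ^^ i) ` A \<noteq> {}" for i B
  proof -
    obtain x where x: "x \<in> B" "x \<in> (g ^^ i) ` A" using ne by blast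
    then obtain a where a: "a \<in> A" "x = (g ^^ i) a" by blast
    have "x \<in> (g ^^ i) ` B" using x fixed_funpow[OF B] by simp
    then obtain b where b: "b \<in> B" "x = (g ^^ i) b" by blast
    have "B \<in> L" using B fixed_sub by blast
    then have "a = b"
      using inj_onD[OF funpow_inj[of i], of a b] a b line_sub[of B] line_sub[OF A(1)] by auto
    then show ?thesis using a b by blast
  qed
  have nonempty: "B \<noteq> {}" if "B \<in> fixed" for B using that fixed_sub line_nonempty by blast
  show ?thesis
  proof unfold_locales
    show "?R \<subseteq> L" using funpow_line[OF A(1)] by blast
    show "?K \<subseteq> L" "?Z \<subseteq> L" using fixed_sub by auto
    have "inj_on (\<lambda>i. ((`) g ^^ i) A) {..<s + 1}"
      by (rule orbit_inj_on_prime_period[OF prime])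
        (use A line_period in \<open>auto simp: fixed_def simp del: funpow.simps\<close>)
    then show "card ?R = s + 1" by (simp add: funpow_image card_image)
    show "2 \<le> card ?K" by (rule K)
  next
    fix B C assume h: "B \<in> ?R" "C \<in> ?R" "B \<noteq> C"
    then obtain i j where ij: "i < s + 1" "j < s + 1" "B = (g ^^ i) ` A" "C = (g ^^ j) ` A" by auto
    have L: "B \<in> L" "C \<in> L" using ij funpow_line[OF A(1)] by auto
    have ym: "(g ^^ i) y \<in> m" "(g ^^ j) y \<in> m"
      using fixed_funpow[OF my(1)] my(2) by blast+
    have yB: "(g ^^ i) y \<in> B" "(g ^^ j) y \<in> C" using my(3) ij by auto
    show "B \<inter> C = {}"
    proof (rule ccontr)
      assume "B \<inter> C \<noteq> {}"
      then obtain x where x: "x \<in> B" "x \<in> C" by blast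
      have "x \<in> m" using no_triangle[OF L mL h(3) x] ym yB by blast
      moreover have "B \<noteq> m" "C \<noteq> m" using not_fixed[OF my(1)] ij by auto
      ultimately have "(g ^^ i) y = (g ^^ j) y"
        using meet_unique[OF L(1) mL _ x(1) _ yB(1) ym(1)]
          meet_unique[OF L(2) mL _ x(2) _ yB(2) ym(2)] by auto
      then have "i = j"
        using inj_onD[OF orbit_inj_on_prime_period[OF prime period[OF yP] no_fixed_point[OF yP]]]
          ij by auto
      then show False using h ij by simp
    qed
  next
    show "B \<inter> C = {}" if "B \<in> ?K" "C \<in> ?K" "B \<noteq> C" for B C
      using fixed_disj that by simp
  next
    fix B C assume h: "B \<in> ?R" "C \<in> ?K"
    then obtain i c where i: "B = (g ^^ i) ` A" "c \<in> C" "c \<in> A" by auto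
    have "(g ^^ i) c \<in> C" using fixed_funpow[of C i] h i by blast
    then show "B \<inter> C \<noteq> {}" using i by auto
  next
    show "?R \<inter> ?K = {}" using not_fixed by auto
  next
    fix B C assume h: "B \<in> ?Z" "C \<in> ?R \<union> ?K"
    show "B \<inter> C = {}"
    proof (cases "C \<in> ?K")
      case True
      then show ?thesis using fixed_disj[of B C] h by auto
    next
      case False
      then obtain i where "C = (g ^^ i) ` A" using h by auto
      then show ?thesis using meet_back[of B i] h by auto
    qed
  qed
qed

text \<open>
  Pigeonhole: from a point \<open>x\<close> of a fixed line \<open>m\<close>, the other fixed lines are reached through the
  \<open>t\<close> lines on \<open>x\<close> different from \<open>m\<close>. One of these meets more than \<open>c\<close> of them, and \<open>m\<close> as well.
\<close>

lemma exists_line_meeting_many_fixed: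
  assumes "t * c + 1 < card fixed"
  shows "\<exists>A\<in>L. A \<notin> fixed \<and> c + 2 \<le> card {B \<in> fixed. B \<inter> A \<noteq> {}}"
proof -
  obtain m where m: "m \<in> fixed" using assms by fastforce
  have mL: "m \<in> L" using m fixed_sub by blast
  obtain x where x: "x \<in> m" using line_nonempty[OF mL] by blast
  have xP: "x \<in> P" using x line_sub[OF mL] by blast
  define N where "N = {A \<in> L. x \<in> A} - {m}"
  define D where "D A = {B \<in> fixed - {m}. B \<inter> A \<noteq> {}}" for A
  have cN: "card N = t" unfolding N_def
    using card_pencil[OF xP] mL x by (subst card_Diff_singleton) auto
  have fN: "finite N" using finite_L by (simp add: N_def)
  have "fixed - {m} \<subseteq> (\<Union>A\<in>N. D A)"
  proof
    fix B assume B: "B \<in> fixed - {m}"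
    have d: "m \<inter> B = {}" using fixed_disj[OF m] B by auto
    have "B \<in> L" using B fixed_sub by auto
    then obtain A where "A \<in> L" "x \<in> A" "A \<inter> B \<noteq> {}" using projection[OF xP, of B] d x by auto
    then show "B \<in> (\<Union>A\<in>N. D A)" using B d by (auto simp: N_def D_def)
  qed
  then have le: "card (fixed - {m}) \<le> (\<Sum>A\<in>N. card (D A))"
    using card_UN_le[OF fN, of D] card_mono[of "\<Union>A\<in>N. D A" "fixed - {m}"] fN finite_fixed
    by (simp add: D_def)
  have "\<exists>A\<in>N. c < card (D A)"
  proof (rule ccontr)
    assume "\<not> ?thesis"
    then have "(\<Sum>A\<in>N. card (D A)) \<le> t * c"
      using sum_bounded_above[of N "\<lambda>A. card (D A)" c] cN by (auto simp: not_less)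
    then show False using le assms m finite_fixed by simp
  qed
  then obtain A where A: "A \<in> N" "c < card (D A)" by blast
  have "{B \<in> fixed. B \<inter> A \<noteq> {}} = insert m (D A)" using A m x by (auto simp: N_def D_def)
  then have "c + 2 \<le> card {B \<in> fixed. B \<inter> A \<noteq> {}}"
    using A finite_fixed by (simp add: D_def)
  moreover have "A \<notin> fixed" using fixed_disj[OF m, of A] A x by (auto simp: N_def)
  ultimately show ?thesis using A by (auto simp: N_def)
qed

end

text \<open>
  With \<open>a = n + u + 1\<close>, so that \<open>s + t = t a\<close>, eliminating \<open>f\<close> and \<open>S\<close> and cancelling \<open>s + 1\<close>
  and \<open>t\<close> leaves \<open>k ((t - 1) a - t) \<le> (t - 3) a + t\<^sup>2 - t\<close>. The left side grows with \<open>k\<close>, and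
  already \<open>k = u + 2\<close> violates the inequality: since \<open>2 a = t + u + 2\<close>, twice the difference of
  the two sides is then \<open>2 t + (t + u + 2) (u - 1) (t - 1) > 0\<close>.
\<close>

lemma grid_counts_contradiction:
  fixes n u t s f k S :: int
  assumes n: "1 \<le> n" and u: "1 \<le> u" and t: "t = 2 * n + u" and s: "s = t * (n + u)"
    and f: "u * t + 3 \<le> f" and k: "u + 2 \<le> k"
    and lines: "(t + 1) * (s * t + 1) = f + (s + 1) + k * ((s + 1) * (t - 1)) + S"
    and skew: "((s + 1) * (s + 1 - k)) * t\<^sup>2 \<le> S * (s + t)"
  shows False
proof -
  define a where "a = n + u + 1"
  \<comment> \<open>\<open>(s + 1) * X\<close> is the value of \<open>S\<close> for the least possible \<open>f\<close>.\<close>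
  define X where "X = t\<^sup>2 + t - 3 - k * (t - 1)"
  have t3: "3 \<le> t" using n u t by simp
  have s0: "0 < s" using t3 n u by (simp add: s)
  have "u * t = 2 * s - t\<^sup>2" unfolding s t by (simp add: power2_eq_square algebra_simps)
  then have "S \<le> (s + 1) * X"
    using f lines by (simp add: X_def power2_eq_square algebra_simps)
  then have "S * (s + t) \<le> ((s + 1) * X) * (s + t)"
    using s0 t3 by (intro mult_right_mono) auto
  then have "(s + 1) * ((s + 1 - k) * t\<^sup>2) \<le> (s + 1) * (X * (s + t))"
    using skew by (simp add: mult.assoc)
  then have "(s + 1 - k) * t\<^sup>2 \<le> X * (s + t)" using s0 by (simp add: mult_le_cancel_left)
  moreover have "s + t = t * a" by (simp add: s a_def algebra_simps)
  ultimately have "t * ((s + 1 - k) * t) \<le> t * (X * a)"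
    by (simp add: power2_eq_square ac_simps)
  then have "(s + 1 - k) * t \<le> X * a" using t3 by (simp add: mult_le_cancel_left)
  moreover have "s = t * (a - 1)" by (simp add: s a_def)
  ultimately have up: "k * ((t - 1) * a - t) \<le> (t - 3) * a + t\<^sup>2 - t"
    by (simp add: X_def power2_eq_square algebra_simps)
  have "t * 1 \<le> (t - 1) * a"
  proof -
    have "(t - 1) * 2 \<le> (t - 1) * a" using t3 n u by (intro mult_left_mono) (auto simp: a_def)
    then show ?thesis using t3 by simp
  qed
  then have low: "(u + 2) * ((t - 1) * a - t) \<le> k * ((t - 1) * a - t)"
    using k by (intro mult_right_mono) auto
  define W where "W = (t + u + 2) * ((u - 1) * (t - 1))"
  have "2 * ((u + 2) * ((t - 1) * a - t) - ((t - 3) * a + t\<^sup>2 - t)) = 2 * t + W"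
    unfolding t a_def W_def by (simp add: power2_eq_square algebra_simps)
  moreover have "(u + 2) * ((t - 1) * a - t) - ((t - 3) * a + t\<^sup>2 - t) \<le> 0"
    using order_trans[OF low up] by (simp only: diff_le_0_iff_le)
  moreover have "0 \<le> W" using t3 u by (simp add: W_def)
  ultimately show False using t3 by simp
qed

theorem (in quadrangle_aut) parameters_excluded:
  assumes n: "0 < n" and q: "2 * n < t" and s: "s = t\<^sup>2 - n * t"
  shows False
proof -
  define u where "u = t - 2 * n"
  have u: "1 \<le> u" and tu: "t = 2 * n + u" using q by (auto simp: u_def)
  have s': "s = t * (n + u)" unfolding s tu
    by (simp add: power2_eq_square algebra_simps)
  have f: "int (u * t + 3) \<le> int (card fixed)"
  proof -
    obtain j where j: "int (card fixed) + (int t)\<^sup>2 - 1 = int (s + 1) * j"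
      using dvd_fixed by (elim dvdE)
    define w where "w = int (n * t)"
    have w: "3 \<le> w" using mult_le_mono[of 1 n 3 t] n q unfolding w_def by linarith
    have e: "(int t)\<^sup>2 = int s + w"
      unfolding s' tu w_def by (simp add: power2_eq_square algebra_simps)
    \<comment> \<open>Here \<open>j \<le> 1\<close> would give \<open>t\<^sup>2 - 1 \<le> s + 1\<close>, whereas \<open>t\<^sup>2 - s = n t \<ge> 3\<close>.\<close>
    have "2 \<le> j"
    proof (rule ccontr)
      assume "\<not> 2 \<le> j"
      then have "int (s + 1) * j \<le> int (s + 1) * 1" by (intro mult_left_mono) auto
      then have "int (card fixed) + (int t)\<^sup>2 - 1 \<le> int s + 1"
        using j by (simp only: mult_1_right of_nat_add of_nat_1)
      then show False using e w by simp
    qed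
    then have "int (s + 1) * 2 \<le> int (s + 1) * j" by (intro mult_left_mono) auto
    then have "2 * int s + 3 - (int t)\<^sup>2 \<le> int (card fixed)" using j by simp
    moreover have "2 * int s - (int t)\<^sup>2 = int (u * t)"
      unfolding s' tu by (simp add: power2_eq_square algebra_simps)
    ultimately show ?thesis by simp
  qed
  then have "t * u + 1 < card fixed" unfolding of_nat_le_iff by (simp add: mult.commute)
  then obtain A where A: "A \<in> L" "A \<notin> fixed" "u + 2 \<le> card {B \<in> fixed. B \<inter> A \<noteq> {}}"
    using exists_line_meeting_many_fixed by blast
  let ?K = "{B \<in> fixed. B \<inter> A \<noteq> {}}" and ?Z = "{B \<in> fixed. B \<inter> A = {}}"
  interpret G: quadrangle_grid P L s t "(\<lambda>i. (g ^^ i) ` A) ` {..<s + 1}" ?K ?Z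
    using grid_of_orbit[OF A(1,2)] A(3) by simp
  have "fixed = ?Z \<union> ?K" by auto
  then have "card fixed = card ?Z + card ?K"
    using card_Un_disjoint[of ?Z ?K] G.fin by auto
  then have "(t + 1) * (s * t + 1)
      = card fixed + (s + 1) + card ?K * ((s + 1) * (t - 1)) + card G.skew"
    using G.card_lines_split card_lines by simp
  then have "int ((t + 1) * (s * t + 1))
      = int (card fixed + (s + 1) + card ?K * ((s + 1) * (t - 1)) + card G.skew)"
    by (rule arg_cong)
  then have lines: "(int t + 1) * (int s * int t + 1)
      = int (card fixed) + (int s + 1) + int (card ?K) * ((int s + 1) * (int t - 1))
        + int (card G.skew)"
    using t_pos
    by (simp only: of_nat_add of_nat_mult of_nat_1 of_nat_diff Suc_leI One_nat_def of_nat_Suc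
        of_nat_0 add_0_right)
  show False
  proof (rule grid_counts_contradiction[of "int n" "int u" "int t" "int s" "int (card fixed)"
        "int (card ?K)" "int (card G.skew)"])
    show "1 \<le> int n" "1 \<le> int u" "int t = 2 * int n + int u" "int s = int t * (int n + int u)"
      using n u tu s' by simp_all
    show "int u * int t + 3 \<le> int (card fixed)" using f by simp
    show "int u + 2 \<le> int (card ?K)" using A(3) by simp
    show "((int s + 1) * (int s + 1 - int (card ?K))) * (int t)\<^sup>2 \<le> int (card G.skew) * (int s + int t)"
      using G.skew_lower_bound by (simp add: add.commute)
  qed (rule lines)
qed

section \<open>Automorphisms of generalized quadrangles\<close>

context generalized_quadrangle
begin

definition on :: "'l \<Rightarrow> 'p set" where
  "on l = {P \<in> points. inc P l}"

lemma on_inj: "inj_on on lines"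
proof (rule inj_onI)
  fix l m assume l: "l \<in> lines" and m: "m \<in> lines" and eq: "on l = on m"
  have "2 \<le> card (on l)" using points_on_line[OF l] s_pos by (simp add: on_def)
  then obtain P Q where PQ: "P \<in> on l" "Q \<in> on l" "P \<noteq> Q"
    by (metis card_le_Suc0_iff_eq card.infinite not_less_eq_eq numeral_2_eq_2 zero_le)
  then show "l = m" using line_unique[of P Q l m] l m eq by (auto simp: on_def)
qed

lemma collinear_iff_on:
  assumes "P \<in> points" "Q \<in> points"
  shows "collinear lines inc P Q \<longleftrightarrow> (\<exists>A\<in>on ` lines. P \<in> A \<and> Q \<in> A)"
  using assms by (auto simp: collinear_def on_def)

sublocale Q: quadrangle points "on ` lines" s t
proof
  show "finite points" "s > 0" "t > 0" "points \<noteq> {}"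
    by (rule finite_points s_pos t_pos points_nonempty)+
  show "A \<subseteq> points" if "A \<in> on ` lines" for A using that by (auto simp: on_def)
  show "card A = s + 1" if "A \<in> on ` lines" for A
    using that points_on_line by (auto simp: on_def)
  show "card {A \<in> on ` lines. x \<in> A} = t + 1" if x: "x \<in> points" for x
  proof -
    have "{A \<in> on ` lines. x \<in> A} = on ` {l \<in> lines. inc x l}" using x by (auto simp: on_def)
    moreover have "inj_on on {l \<in> lines. inc x l}" using on_inj by (rule inj_on_subset) auto
    ultimately show ?thesis using lines_on_point[OF x] by (simp add: card_image)
  qed
  show "x = y" if "A \<in> on ` lines" "B \<in> on ` lines" "A \<noteq> B" "x \<in> A" "x \<in> B" "y \<in> A" "y \<in> B"
    for A B x y
  proof -
    from that(1,2) obtain l m where "l \<in> lines" "m \<in> lines" "A = on l" "B = on m" by blast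
    then show ?thesis using point_unique[of l m x y] that by (auto simp: on_def)
  qed
next
  fix x A assume x: "x \<in> points" and A: "A \<in> on ` lines" and xA: "x \<notin> A"
  then obtain l where l: "l \<in> lines" "A = on l" "\<not> inc x l" by (auto simp: on_def)
  obtain y m where "y \<in> points" "m \<in> lines" "inc x m" "inc y m" "inc y l"
    using ex1_implies_ex[OF unique_projection[OF x l(1,3)]] by auto
  then show "\<exists>B\<in>on ` lines. x \<in> B \<and> B \<inter> A \<noteq> {}" using x l by (auto simp: on_def)
next
  fix A B C x
  assume h: "A \<in> on ` lines" "B \<in> on ` lines" "C \<in> on ` lines" "A \<noteq> B" "x \<in> A" "x \<in> B"
    "A \<inter> C \<noteq> {}" "B \<inter> C \<noteq> {}"
  then obtain l m k where lmk: "l \<in> lines" "m \<in> lines" "k \<in> lines" "A = on l" "B = on m" "C = on k"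
    by auto
  obtain y z where yz: "y \<in> A" "y \<in> C" "z \<in> B" "z \<in> C" using h by auto
  have x: "x \<in> points" using h(5) lmk by (auto simp: on_def)
  show "x \<in> C"
  proof (rule ccontr)
    assume "x \<notin> C"
    then have "\<not> inc x k" using x lmk by (auto simp: on_def)
    from unique_projection[OF x lmk(3) this]
    have "(y, l) = (z, m)"
      by (rule ex1E) (use h yz lmk in \<open>auto simp: on_def\<close>)
    then show False using h lmk by simp
  qed
qed

text \<open>
  The image of the line through \<open>x\<close> and \<open>y\<close> is the line through \<open>g x\<close> and \<open>g y\<close>, as both consist of
  the points collinear with the two given ones.
\<close>

lemma automorphism_line_image:
  assumes g: "g \<in> automorphisms points lines inc" and A: "A \<in> on ` lines"
  shows "g ` A \<in> on ` lines"
proof -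
  have bij: "bij_betw g points points" using g by (simp add: automorphisms_def Bij_def)
  have into: "g x \<in> points" if "x \<in> points" for x using bij that by (auto simp: bij_betw_def)
  define co where "co x y \<longleftrightarrow> (\<exists>B\<in>on ` lines. x \<in> B \<and> y \<in> B)" for x y
  have pres: "co (g x) (g y) \<longleftrightarrow> co x y" if "x \<in> points" "y \<in> points" for x y
    using g collinear_iff_on[OF that] collinear_iff_on[OF into into, OF that] that
    by (simp add: automorphisms_def co_def)
  have perp: "B = {z \<in> points. co z x \<and> co z y}"
    if "B \<in> on ` lines" "x \<in> B" "y \<in> B" "x \<noteq> y" for B x y
    using Q.line_eq_perp[OF that] unfolding co_def .
  have "2 \<le> card A" using Q.card_line[OF A] s_pos by simp
  then obtain x y where xy: "x \<in> A" "y \<in> A" "x \<noteq> y"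
    by (metis card_le_Suc0_iff_eq card.infinite not_less_eq_eq numeral_2_eq_2 zero_le)
  have xyP: "x \<in> points" "y \<in> points" using xy Q.line_sub[OF A] by auto
  have "co (g x) (g y)" using pres[OF xyP] A xy by (auto simp: co_def)
  then obtain B where B: "B \<in> on ` lines" "g x \<in> B" "g y \<in> B" by (auto simp: co_def)
  have "g x \<noteq> g y" using bij xy xyP by (auto simp: bij_betw_def inj_on_def)
  then have Bp: "B = {z \<in> points. co z (g x) \<and> co z (g y)}" using perp B by blast
  have "g ` A = B"
  proof (intro equalityI subsetI)
    fix w assume "w \<in> g ` A"
    then obtain z where z: "z \<in> A" "w = g z" by auto
    have zP: "z \<in> points" using z Q.line_sub[OF A] by auto
    have "co z x" "co z y" using z xy A by (auto simp: co_def)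
    then show "w \<in> B" using Bp pres[OF zP] xyP into[OF zP] z by simp
  next
    fix w assume w: "w \<in> B"
    then have "w \<in> points" using Bp by blast
    then obtain z where z: "z \<in> points" "w = g z" using bij by (auto simp: bij_betw_def)
    then have "co z x" "co z y" using w Bp pres[OF z(1)] xyP by auto
    then have "z \<in> A" using z(1) by (subst perp[OF A xy]) simp
    then show "w \<in> g ` A" using z(2) by (rule rev_image_eqI)
  qed
  then show ?thesis using B(1) by (simp only:)
qed

end

lemma BijGroup_pow_apply:
  assumes "g \<in> Bij E" "x \<in> E"
  shows "(g [^]\<^bsub>BijGroup E\<^esub> n) x = (g ^^ n) x"
proof -
  have carrier: "carrier (BijGroup E) = Bij E" by (simp add: BijGroup_def)
  have mult: "f \<otimes>\<^bsub>BijGroup E\<^esub> h = compose E f h" if "f \<in> Bij E" "h \<in> Bij E" for f h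
    using that by (simp add: BijGroup_def)
  have B: "g [^]\<^bsub>BijGroup E\<^esub> n \<in> Bij E" for n :: nat
    using monoid.nat_pow_closed[OF group.is_monoid[OF group_BijGroup], of g E n] assms(1)
    by (simp only: carrier)
  have "\<forall>x\<in>E. (g [^]\<^bsub>BijGroup E\<^esub> n) x = (g ^^ n) x"
  proof (induction n)
    case 0
    then show ?case by (simp add: BijGroup_def)
  next
    case (Suc n)
    have "g [^]\<^bsub>BijGroup E\<^esub> Suc n = compose E (g [^]\<^bsub>BijGroup E\<^esub> n) g"
      using mult[OF B[of n] assms(1)] by simp
    moreover have "g x \<in> E" if "x \<in> E" for x using Bij_imp_funcset[OF assms(1)] that by auto
    ultimately show ?case using Suc by (simp add: compose_eq funpow_swap1)
  qed
  then show ?thesis using assms by blast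
qed

lemma automorphism_group_pow:
  "g [^]\<^bsub>automorphism_group points lines inc\<^esub> (n::nat) = g [^]\<^bsub>BijGroup points\<^esub> n"
  by (simp add: automorphism_group_def nat_pow_def)

lemma (in generalized_quadrangle) no_automorphism_of_period:
  assumes n: "0 < n" "2 * n < t" "s = t\<^sup>2 - n * t" and p: "prime (s + 1)"
    and g: "g \<in> automorphisms points lines inc"
    and pow: "g [^]\<^bsub>BijGroup points\<^esub> (s + 1) = \<one>\<^bsub>BijGroup points\<^esub>"
  shows "g = \<one>\<^bsub>BijGroup points\<^esub>"
proof (rule ccontr)
  assume ne: "g \<noteq> \<one>\<^bsub>BijGroup points\<^esub>"
  have gB: "g \<in> Bij points" using g by (simp add: automorphisms_def)
  have "t * 1 < t * (t - n)" using n by (intro mult_strict_left_mono) auto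
  then have ts: "t < s" using n(3) by (simp add: power2_eq_square diff_mult_distrib2 mult.commute)
  interpret A: quadrangle_aut points "on ` lines" s t g
  proof
    show "bij_betw g points points" using gB by (simp add: Bij_def)
    show "g ` A \<in> on ` lines" if "A \<in> on ` lines" for A by (rule automorphism_line_image[OF g that])
    show "(g ^^ (s + 1)) x = x" if "x \<in> points" for x
      using BijGroup_pow_apply[OF gB that, of "s + 1"] that unfolding pow by (simp add: BijGroup_def)
    show "\<exists>x\<in>points. g x \<noteq> x"
    proof (rule ccontr)
      assume "\<not> ?thesis"
      then have "g = (\<lambda>x\<in>points. x)"
        using Bij_imp_extensional[OF gB] by (intro extensionalityI[of _ points]) auto
      then show False using ne by (simp add: BijGroup_def)
    qed
  qed (rule p ts)+
  show False by (rule A.parameters_excluded[OF n])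
qed

lemma (in transitive_action) card_dvd_order:
  assumes "E \<noteq> {}"
  shows "card E dvd order G"
proof -
  obtain x where x: "x \<in> E" using assms by blast
  have "orbit G \<phi> x = E"
    using unique_orbit[OF x] element_image[OF _ x] by (auto simp: orbit_def)
  then show ?thesis using orbit_stabilizer_theorem[OF x] by (metis dvd_triv_left)
qed

text \<open>
  Cauchy's theorem: Sylow's theorem provides a subgroup of order \<open>p\<close>, also when \<open>p\<^sup>2\<close> divides the
  order of the group.
\<close>

lemma (in group) exists_element_of_prime_period:
  assumes p: "prime p" and dvd: "p dvd order G" and fin: "finite (carrier G)"
  shows "\<exists>g\<in>carrier G. g \<noteq> \<one> \<and> g [^] p = \<one>"
proof -
  obtain m where "order G = p ^ 1 * m" using dvd by auto
  then obtain H where H: "subgroup H G" "card H = p"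
    using sylow_thm[OF p is_group _ fin, of 1 m] by auto
  have "H \<noteq> {\<one>}" using H p by auto
  then obtain g where g: "g \<in> H" "g \<noteq> \<one>" using subgroup.one_closed[OF H(1)] by blast
  interpret S: group "G\<lparr>carrier := H\<rparr>" by (rule subgroup_imp_group[OF H(1)])
  have "g [^]\<^bsub>G\<lparr>carrier := H\<rparr>\<^esub> order (G\<lparr>carrier := H\<rparr>) = \<one>\<^bsub>G\<lparr>carrier := H\<rparr>\<^esub>"
    using S.pow_order_eq_1[of g] g by simp
  then have "g [^] p = \<one>" using H by (simp add: order_def nat_pow_def)
  then show ?thesis using g subgroup.subset[OF H(1)] by blast
qed

theorem corollary1p5:
  fixes n q :: nat
    and points :: "'p set" and lines :: "'l set" and inc :: "'p \<Rightarrow> 'l \<Rightarrow> bool"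
  assumes "n > 0" and "q > 0" and "2 * n < q"
    and "prime (q^2 - n * q + 1)"
    and "generalized_quadrangle points lines inc (q^2 - n * q) q"
  defines "Aut \<equiv> automorphism_group points lines inc"
  shows "\<not> (\<exists>g \<in> carrier Aut. group.ord Aut g = q^2 - n * q + 1)
    \<and> \<not> (\<exists>H. subgroup H Aut \<and> transitive_action (Aut\<lparr>carrier := H\<rparr>) points (\<lambda>g. g))"
proof -
  let ?p = "q^2 - n * q + 1"
  interpret GQ: generalized_quadrangle points lines inc "q^2 - n * q" q by (rule assms(5))
  interpret Aut: group Aut unfolding Aut_def by (rule group_automorphism_group)
  have carrier: "carrier Aut = automorphisms points lines inc"
    by (simp add: Aut_def automorphism_group_def)
  have one: "\<one>\<^bsub>Aut\<^esub> = \<one>\<^bsub>BijGroup points\<^esub>" by (simp add: Aut_def automorphism_group_def)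
  have pow: "g [^]\<^bsub>Aut\<^esub> k = g [^]\<^bsub>BijGroup points\<^esub> k" for g and k :: nat
    unfolding Aut_def by (rule automorphism_group_pow)
  have trivial: "g = \<one>\<^bsub>Aut\<^esub>" if "g \<in> carrier Aut" "g [^]\<^bsub>Aut\<^esub> ?p = \<one>\<^bsub>Aut\<^esub>" for g
    using GQ.no_automorphism_of_period[OF assms(1,3) refl assms(4), of g] that
    unfolding carrier one pow by blast
  have "\<not> (\<exists>g \<in> carrier Aut. group.ord Aut g = ?p)"
  proof
    assume "\<exists>g \<in> carrier Aut. group.ord Aut g = ?p"
    then obtain g where g: "g \<in> carrier Aut" "Aut.ord g = ?p" by blast
    then have "g = \<one>\<^bsub>Aut\<^esub>" using trivial[of g] Aut.pow_ord_eq_1[of g] by simp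
    then have "?p dvd 1" using Aut.pow_eq_id[of g 1] g by simp
    then show False using assms(4) not_prime_unit by blast
  qed
  moreover have "\<not> (\<exists>H. subgroup H Aut \<and> transitive_action (Aut\<lparr>carrier := H\<rparr>) points (\<lambda>g. g))"
  proof
    assume "\<exists>H. subgroup H Aut \<and> transitive_action (Aut\<lparr>carrier := H\<rparr>) points (\<lambda>g. g)"
    then obtain H where H: "subgroup H Aut"
      and tr: "transitive_action (Aut\<lparr>carrier := H\<rparr>) points (\<lambda>g. g)" by blast
    interpret H: group "Aut\<lparr>carrier := H\<rparr>" by (rule Aut.subgroup_imp_group[OF H])
    have "H \<subseteq> Bij points"
      using subgroup.subset[OF H] unfolding carrier automorphisms_def by blast
    also have "\<dots> \<subseteq> points \<rightarrow>\<^sub>E points"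
      using Bij_imp_extensional Bij_imp_funcset unfolding PiE_def by blast
    finally have fin: "finite H"
      by (rule finite_subset) (intro finite_PiE GQ.finite_points)
    have "?p dvd card points" unfolding GQ.Q.card_points by (rule dvd_triv_left)
    then have "?p dvd order (Aut\<lparr>carrier := H\<rparr>)"
      using transitive_action.card_dvd_order[OF tr GQ.points_nonempty] by (rule dvd_trans)
    then obtain g where g: "g \<in> H" "g \<noteq> \<one>\<^bsub>Aut\<^esub>" "g [^]\<^bsub>Aut\<lparr>carrier := H\<rparr>\<^esub> ?p = \<one>\<^bsub>Aut\<^esub>"
      using H.exists_element_of_prime_period[OF assms(4)] fin by auto
    then have "g [^]\<^bsub>Aut\<^esub> ?p = \<one>\<^bsub>Aut\<^esub>" by (simp add: nat_pow_def)
    then show False using trivial g subgroup.subset[OF H] by blast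
  qed
  ultimately show ?thesis by blast
qed

end
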